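(* Let $q$ be a prime power, let $n,d\in\mathbb{N}$ with $2\le d\le n$, and let $G = \overline{\mathcal{G}_{q,n,d}}$ be the complement of the generalized-Hamming graph, with adjacency matrix $A(G)$. (1) $A(G)$ admits the decomposition $A(G) = \sum_{j=0}^{n}\gamma_j E_j$, where the scalars $\gamma_j$ are the eigenvalues of $A(G)$, given by $$\gamma_0 = \Delta(G), \qquad \gamma_j = -K_{d-1}(j-1;\,n-1,\,q) \quad (1\le j\le n),$$ and $\Delta(G) = \sum_{i=d}^{n}\binom{n}{i}(q-1)^i$ denotes the degree of the regular graph $G$. (2) $\gamma_1 < \gamma_m$ for every $m$ with $2\le m\le n-1$. (3) $\gamma_1=\gamma_n$ if and only if $q=2$ and $d$ is odd. (4) For every polynomial $p$, $p(A(G)) = \sum_{j=0}^{n} p(\gamma_j)\,E_j$.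
   Context: The generalized-Hamming graph $\mathcal{G}_{q,n,d}$ is the simple undirected graph with vertex set $\mathbb{F}_q^n$ in which two distinct vertices are adjacent if and only if their Hamming distance is less than $d$; in its complement, two vertices are adjacent if and only if their Hamming distance is at least $d$. The $q$-ary Krawtchouk polynomial is $K_\ell(i;n,q) = \sum_{r=0}^{\ell}\binom{i}{r}\binom{n-i}{\ell-r}(-1)^r(q-1)^{\ell-r}$ for $0\le i,\ell\le n$. For $0\le i\le n$, $A_i$ is the $q^n\times q^n$ $0/1$ matrix indexed by $\mathbb{F}_q^n$ with $(A_i)_{u,v}=1$ iff $u,v$ differ in exactly $i$ coordinates (the Hamming scheme). The matrices $E_0,\dots,E_n$ are the primitive idempotents of the Hamming scheme, $E_k = q^{-n}\sum_{i=0}^{n}K_k(i;n,q)A_i$; they are pairwise orthogonal projections, $E_iE_j=\delta_{ij}E_i$, and $A_i=\sum_{k=0}^n K_i(k;n,q)E_k$.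
   Formalization: Part (2) is proved except when q = 2, d = n and m is odd; there it is false, since then γ_m = (-1)^m, so γ_1 = γ_m = -1 (for example q = 2, n = d = 4, m = 3). *)

theory Defs
  imports "HOL-Analysis.Analysis" "HOL-Computational_Algebra.Polynomial"
begin

(* Simple graphs on the vertex type 'v are given by their adjacency relation. *)

definition graph_complement :: "('v \<Rightarrow> 'v \<Rightarrow> bool) \<Rightarrow> 'v \<Rightarrow> 'v \<Rightarrow> bool" where
  "graph_complement G u v \<longleftrightarrow> u \<noteq> v \<and> \<not> G u v"

definition vertex_degree :: "('v::finite \<Rightarrow> 'v \<Rightarrow> bool) \<Rightarrow> 'v \<Rightarrow> nat" where
  "vertex_degree G u = card {v. G u v}"

definition adjacency_matrix :: "('v::finite \<Rightarrow> 'v \<Rightarrow> bool) \<Rightarrow> real^'v^'v" where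
  "adjacency_matrix G = (\<chi> u v. if G u v then 1 else 0)"

definition hamming_dist :: "'a^'n \<Rightarrow> 'a^'n \<Rightarrow> nat" where
  "hamming_dist u v = card {i. u $ i \<noteq> v $ i}"

definition gen_hamming_graph :: "nat \<Rightarrow> 'a^'n \<Rightarrow> 'a^'n \<Rightarrow> bool" where
  "gen_hamming_graph d u v \<longleftrightarrow> u \<noteq> v \<and> hamming_dist u v < d"

(* krawtchouk l i n q is K_l(i; n, q), used for i \<le> n and l \<le> n only. *)
definition krawtchouk :: "nat \<Rightarrow> nat \<Rightarrow> nat \<Rightarrow> nat \<Rightarrow> real" where
  "krawtchouk l i n q =
     (\<Sum>r=0..l. real (i choose r) * real ((n - i) choose (l - r)) * (-1) ^ r * (real q - 1) ^ (l - r))"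

definition hamming_scheme_matrix :: "nat \<Rightarrow> real^('a::finite^'n)^('a^'n)" where
  "hamming_scheme_matrix i = (\<chi> u v. if hamming_dist u v = i then 1 else 0)"

(* The length n = CARD('n) and the alphabet size q = CARD('a) are read off the type. *)
definition hamming_idempotent :: "nat \<Rightarrow> real^('a::finite^'n)^('a^'n)" where
  "hamming_idempotent k =
     (1 / real CARD('a) ^ CARD('n)) *\<^sub>R
     (\<Sum>i=0..CARD('n). krawtchouk k i CARD('n) CARD('a) *\<^sub>R hamming_scheme_matrix i)"

definition matrix_eigenvalue :: "real^'v^'v \<Rightarrow> real \<Rightarrow> bool" where
  "matrix_eigenvalue A c \<longleftrightarrow> (\<exists>x. x \<noteq> 0 \<and> A *v x = c *s x)"

(* On vectors of vectors, the library's power operation is componentwise, not the matrix power. *)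
primrec matrix_power :: "real^'v^'v \<Rightarrow> nat \<Rightarrow> real^'v^'v" where
  "matrix_power A 0 = mat 1"
| "matrix_power A (Suc k) = A ** matrix_power A k"

definition matrix_poly :: "real poly \<Rightarrow> real^'v^'v \<Rightarrow> real^'v^'v" where
  "matrix_poly p A = (\<Sum>k\<le>degree p. coeff p k *\<^sub>R matrix_power A k)"

(* For q = 2 and d = n the graph complement is a perfect matching, with eigenvalues
   gamma_j = (-1)^j. Then gamma_1 = gamma_m for every odd m, which is why the strict inequality
   gamma_1 < gamma_m needs that exception. The smallest instance is q = 2, d = n = 4, m = 3: *)
lemma strict_minimality_exception: "- krawtchouk (4 - 1) (1 - 1) (4 - 1) 2 = - krawtchouk (4 - 1) (3 - 1) (4 - 1) 2"
  by (simp add: krawtchouk_def numeral_eq_Suc)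

end

theory Submission
  imports Defs
begin

text \<open>Let \<open>J\<close> be the \<open>q \<times> q\<close> all-ones matrix. The tensor products over the coordinates with factor
  \<open>I - J/q\<close> at the coordinates in a set \<open>S\<close> and \<open>J/q\<close> elsewhere are orthogonal projections, and
  \<open>E\<^sub>k\<close> is their sum over \<open>|S| = k\<close>; expanding tensor powers with an indeterminate gives
  \<open>A\<^sub>i = \<Sum>\<^sub>k K\<^sub>i(k) E\<^sub>k\<close>. No characters of the field are needed.
  Since \<open>K\<^sub>l(i; n)\<close> is the coefficient of \<open>x\<^sup>l\<close> in \<open>(1 - x)\<^sup>i (1 + (q - 1) x)\<^sup>n\<^sup>-\<^sup>i\<close>, one has
  \<open>K\<^sub>l(j; n) = K\<^sub>l(j - 1; n - 1) - K\<^sub>l\<^sub>-\<^sub>1(j - 1; n - 1)\<close>, so that the sum of the \<open>K\<^sub>i(j; n)\<close> over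
  \<open>d \<le> i \<le> n\<close> telescopes to \<open>- K\<^sub>d\<^sub>-\<^sub>1(j - 1; n - 1)\<close>. The strict minimality of \<open>\<gamma>\<^sub>1\<close> compares
  \<open>K\<^sub>l(i)\<close> term by term with the Vandermonde expansion of \<open>K\<^sub>l(0)\<close>: a nonzero term loses strictly
  if \<open>r\<close> is odd, or if \<open>r > 0\<close> and \<open>q > 2\<close>.\<close>

section \<open>Matrices with an orthogonal spectral decomposition\<close>

lemma matrix_mult_sum_left:
  fixes M :: "'b \<Rightarrow> real^'v^'v::finite"
  shows "sum M J ** B = (\<Sum>j\<in>J. M j ** B)"
  by (simp add: vec_eq_iff matrix_matrix_mult_def sum_component sum_distrib_right)
    (intro allI sum.swap)

lemma matrix_mult_sum_right:
  fixes M :: "'b \<Rightarrow> real^'v^'v::finite"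
  shows "B ** sum M J = (\<Sum>j\<in>J. B ** M j)"
  by (simp add: vec_eq_iff matrix_matrix_mult_def sum_component sum_distrib_left)
    (intro allI sum.swap)

lemma matrix_vector_mult_sum_left:
  fixes M :: "'b \<Rightarrow> real^'v^'v::finite"
  shows "sum M J *v x = (\<Sum>j\<in>J. M j *v x)"
  by (induction J rule: infinite_finite_induct)
    (simp_all add: matrix_vector_mult_add_rdistrib)

locale spectral_decomposition =
  fixes J :: "'i set" and E :: "'i \<Rightarrow> real^'v^'v::finite"
  assumes finite_J: "finite J"
    and orthogonal: "i \<in> J \<Longrightarrow> j \<in> J \<Longrightarrow> E i ** E j = (if i = j then E i else 0)"
    and complete: "(\<Sum>j\<in>J. E j) = mat 1"
    and nonzero: "j \<in> J \<Longrightarrow> E j \<noteq> 0"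
begin

lemma mult_combination:
  "(\<Sum>j\<in>J. a j *\<^sub>R E j) ** (\<Sum>j\<in>J. b j *\<^sub>R E j) = (\<Sum>j\<in>J. (a j * b j) *\<^sub>R E j)"
proof -
  have "(\<Sum>j\<in>J. a j *\<^sub>R E j) ** (\<Sum>j\<in>J. b j *\<^sub>R E j)
      = (\<Sum>i\<in>J. \<Sum>j\<in>J. (a i * b j) *\<^sub>R (E i ** E j))"
    unfolding matrix_mult_sum_left
    by (simp add: matrix_mult_sum_right matrix_scalar_ac scalar_matrix_assoc mult.commute)
  also have "\<dots> = (\<Sum>i\<in>J. \<Sum>j\<in>J. if i = j then (a i * b i) *\<^sub>R E i else 0)"
    by (intro sum.cong) (auto simp: orthogonal)
  also have "\<dots> = (\<Sum>j\<in>J. (a j * b j) *\<^sub>R E j)"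
    using finite_J by (simp add: sum.delta')
  finally show ?thesis .
qed

text \<open>\<open>E i\<close> is itself a combination, with indicator coefficients, so both
  identities are instances of \<open>mult_combination\<close>.\<close>

lemma mult_combination_idempotent:
  assumes "i \<in> J"
  shows "E i ** (\<Sum>j\<in>J. a j *\<^sub>R E j) = a i *\<^sub>R E i"
    and "(\<Sum>j\<in>J. a j *\<^sub>R E j) ** E i = a i *\<^sub>R E i"
proof -
  have E_i: "E i = (\<Sum>j\<in>J. (if j = i then 1 else 0) *\<^sub>R E j)"
    using finite_J assms by (simp add: if_distrib [where f = "\<lambda>x. x *\<^sub>R _"] cong: if_cong)
  have "(\<Sum>j\<in>J. (c j * (if j = i then 1 else 0)) *\<^sub>R E j) = c i *\<^sub>R E i" for c
    using finite_J assms sum.delta [of J i "\<lambda>j. c j *\<^sub>R E j"]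
    by (simp add: if_distrib [where f = "\<lambda>x. _ * x"] if_distrib [where f = "\<lambda>x. x *\<^sub>R _"] cong: if_cong)
  then show "(\<Sum>j\<in>J. a j *\<^sub>R E j) ** E i = a i *\<^sub>R E i"
    and "E i ** (\<Sum>j\<in>J. a j *\<^sub>R E j) = a i *\<^sub>R E i"
    using mult_combination [of a "\<lambda>j. if j = i then 1 else 0"]
      mult_combination [of "\<lambda>j. if j = i then 1 else 0" a]
    by (simp_all add: E_i [symmetric] mult.commute)
qed

lemma matrix_power_combination:
  "matrix_power (\<Sum>j\<in>J. a j *\<^sub>R E j) k = (\<Sum>j\<in>J. a j ^ k *\<^sub>R E j)"
  by (induction k) (simp_all add: complete mult_combination)

lemma matrix_poly_combination:
  "matrix_poly p (\<Sum>j\<in>J. a j *\<^sub>R E j) = (\<Sum>j\<in>J. poly p (a j) *\<^sub>R E j)"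
proof -
  have "matrix_poly p (\<Sum>j\<in>J. a j *\<^sub>R E j)
      = (\<Sum>k\<le>degree p. \<Sum>j\<in>J. (coeff p k * a j ^ k) *\<^sub>R E j)"
    by (simp add: matrix_poly_def matrix_power_combination scaleR_sum_right)
  also have "\<dots> = (\<Sum>j\<in>J. \<Sum>k\<le>degree p. (coeff p k * a j ^ k) *\<^sub>R E j)"
    by (rule sum.swap)
  finally show ?thesis
    by (simp add: poly_altdef scaleR_sum_left)
qed

text \<open>By completeness an eigenvector \<open>x\<close> has some component
  \<open>E i *v x\<close> that is nonzero, and applying \<open>E i\<close> to the eigenvalue
  equation forces \<open>c = a i\<close>. Conversely, every nonzero vector in the range of
  \<open>E i\<close> is an eigenvector for \<open>a i\<close>.\<close>

lemma eigenvalues_combination: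
  "{c. matrix_eigenvalue (\<Sum>j\<in>J. a j *\<^sub>R E j) c} = a ` J" (is "{c. matrix_eigenvalue ?A c} = _")
proof (intro set_eqI iffI)
  fix c
  assume "c \<in> {c. matrix_eigenvalue ?A c}"
  then obtain x where x: "x \<noteq> 0" "?A *v x = c *s x"
    by (auto simp: matrix_eigenvalue_def)
  have "(\<Sum>j\<in>J. E j *v x) \<noteq> 0"
    using x(1) by (simp add: matrix_vector_mult_sum_left [symmetric] complete)
  then obtain i where i: "i \<in> J" "E i *v x \<noteq> 0"
    by (meson sum.neutral)
  have "a i *\<^sub>R (E i *v x) = E i *v (?A *v x)"
    using i(1)
    by (simp add: matrix_vector_mul_assoc mult_combination_idempotent scaleR_matrix_vector_assoc [symmetric])
  also have "\<dots> = c *\<^sub>R (E i *v x)"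
    by (simp add: x(2) scalar_mult_eq_scaleR matrix_vector_mult_scaleR)
  finally show "c \<in> a ` J"
    using i by auto
next
  fix c
  assume "c \<in> a ` J"
  then obtain i where i: "i \<in> J" "c = a i"
    by blast
  obtain y where y: "E i *v y \<noteq> 0"
    using nonzero [OF i(1)] by (metis matrix_eq matrix_vector_mult_0)
  have "?A *v (E i *v y) = c *s (E i *v y)"
    using i
    by (simp add: matrix_vector_mul_assoc mult_combination_idempotent
        scaleR_matrix_vector_assoc [symmetric] scalar_mult_eq_scaleR)
  with y show "c \<in> {c. matrix_eigenvalue ?A c}"
    by (auto simp: matrix_eigenvalue_def)
qed

end

section \<open>Krawtchouk polynomials\<close>

lemma coeff_linear_power:
  "coeff ([:1, a:] ^ m) k = of_nat (m choose k) * (a :: 'a :: comm_ring_1) ^ k"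
proof -
  have "[:1, a:] ^ m = (monom a 1 + 1) ^ m"
    by (simp add: monom_Suc one_pCons monom_0)
  also have "\<dots> = (\<Sum>r\<le>m. monom (of_nat (m choose r) * a ^ r) r)"
    by (simp add: binomial_ring monom_power of_nat_poly mult_monom [of _ 0, unfolded monom_0, simplified])
  finally show ?thesis
    by (cases "k \<le> m") (simp_all add: coeff_sum sum.delta if_distrib binomial_eq_0)
qed

lemma coeff_krawtchouk_poly:
  "coeff ([:1, -1:] ^ i * [:1, real q - 1:] ^ (n - i)) l = krawtchouk l i n q"
  unfolding krawtchouk_def coeff_mult coeff_linear_power atMost_atLeast0
  by (intro sum.cong) auto

lemma krawtchouk_0: "krawtchouk l 0 n q = real (n choose l) * (real q - 1) ^ l"
  using coeff_krawtchouk_poly [of 0 q n l] by (simp add: coeff_linear_power)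

lemma krawtchouk_zero_deg: "krawtchouk 0 i n q = 1"
  by (simp add: krawtchouk_def)

lemma krawtchouk_last: "krawtchouk l n n q = real (n choose l) * (-1) ^ l"
  using coeff_krawtchouk_poly [of n q n l] by (simp add: coeff_linear_power)

lemma krawtchouk_eq_0:
  assumes "i \<le> n" "n < l"
  shows "krawtchouk l i n q = 0"
  unfolding krawtchouk_def
proof (intro sum.neutral ballI)
  fix r
  have "i < r \<or> n - i < l - r"
    using assms by linarith
  then show "real (i choose r) * real (n - i choose (l - r)) * (- 1) ^ r * (real q - 1) ^ (l - r) = 0"
    by (auto simp: binomial_eq_0)
qed

text \<open>Split one factor \<open>1 - x\<close> off the generating polynomial and compare
  coefficients.\<close>

lemma krawtchouk_Suc:
  "krawtchouk (Suc l) (Suc i) (Suc n) q = krawtchouk (Suc l) i n q - krawtchouk l i n q"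
proof -
  have "krawtchouk (Suc l) (Suc i) (Suc n) q
      = coeff ([:1, -1:] * ([:1, -1:] ^ i * [:1, real q - 1:] ^ (n - i))) (Suc l)"
    by (simp only: coeff_krawtchouk_poly [symmetric] diff_Suc_Suc power_Suc mult.assoc)
  then show ?thesis
    by (simp add: coeff_krawtchouk_poly)
qed

lemma sum_krawtchouk:
  assumes "i \<le> n" "l \<le> n"
  shows "(\<Sum>k = Suc l..Suc n. krawtchouk k (Suc i) (Suc n) q) = - krawtchouk l i n q"
proof -
  have "(\<Sum>k = Suc l..Suc n. krawtchouk k (Suc i) (Suc n) q)
      = (\<Sum>k = l..n. krawtchouk (Suc k) i n q - krawtchouk k i n q)"
    by (simp only: sum.shift_bounds_cl_Suc_ivl krawtchouk_Suc)
  also have "\<dots> = krawtchouk (Suc n) i n q - krawtchouk l i n q"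
    using assms sum_Suc_diff [of l n "\<lambda>k. krawtchouk k i n q"] by simp
  finally show ?thesis
    using assms by (simp add: krawtchouk_eq_0)
qed

lemma krawtchouk_less_krawtchouk_0:
  assumes q: "2 \<le> q" and i: "1 \<le> i" "i < n" and l: "1 \<le> l" "l \<le> n"
    and exception: "\<not> (q = 2 \<and> l = n \<and> even i)"
  shows "krawtchouk l i n q < krawtchouk l 0 n q"
proof -
  define c where "c r = real (i choose r) * real (n - i choose (l - r))" for r
  have sign_le: "(-1) ^ r * (real q - 1) ^ (l - r) \<le> (real q - 1) ^ l" if "r \<le> l" for r
  proof -
    have "(-1) ^ r * (real q - 1) ^ (l - r) \<le> 1 * (real q - 1) ^ (l - r)"
      using q by (intro mult_right_mono) (auto simp: minus_one_power_iff)
    also have "\<dots> \<le> (real q - 1) ^ l"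
      using q by (auto intro!: power_increasing)
    finally show ?thesis .
  qed
  have sign_less: "(-1) ^ r * (real q - 1) ^ (l - r) < (real q - 1) ^ l"
    if r: "1 \<le> r" "r \<le> l" and "odd r \<or> q \<noteq> 2" for r
  proof (cases "odd r")
    case True
    have "0 < (real q - 1) ^ (l - r)" "0 < (real q - 1) ^ l"
      using q by auto
    with True show ?thesis
      by (simp add: minus_one_power_iff)
  next
    case False
    with that q have "3 \<le> q" by auto
    then have "(real q - 1) ^ (l - r) < (real q - 1) ^ l"
      using r by (intro power_strict_increasing) auto
    with False show ?thesis
      by (simp add: minus_one_power_iff)
  qed
  \<comment> \<open>A term with nonzero binomials that loses strictly. If \<open>l = n\<close>, only
    \<open>r = i\<close> has nonzero binomials, hence the exception for \<open>q = 2\<close> and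
    even \<open>i\<close>. If \<open>l < n\<close>, both \<open>min i l\<close> and its predecessor
    are admissible whenever positive, and the odd one of them is taken.\<close>
  obtain r where r: "1 \<le> r" "r \<le> l" "r \<le> i" "l - r \<le> n - i" "odd r \<or> q \<noteq> 2"
  proof (cases "l = n")
    case True
    then show ?thesis
      using that [of i] i exception by auto
  next
    case False
    show ?thesis
    proof (cases "odd (min i l)")
      case True
      then show ?thesis
        using that [of "min i l"] i l False by auto
    next
      case even: False
      then have "2 \<le> min i l"
        using i l by (cases "min i l = 1") auto
      moreover have "odd (min i l - 1)"
        using even calculation by simp
      ultimately show ?thesis
        using that [of "min i l - 1"] i l False by (auto simp: min_def split: if_splits)
    qed
  qed
  have "0 < c r"
    using r by (simp add: c_def)
  have "krawtchouk l i n q = (\<Sum>r\<le>l. c r * ((-1) ^ r * (real q - 1) ^ (l - r)))"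
    by (simp add: krawtchouk_def c_def mult.assoc atMost_atLeast0)
  also have "\<dots> < (\<Sum>r\<le>l. c r * (real q - 1) ^ l)"
  proof (rule sum_strict_mono_ex1)
    show "\<forall>r\<in>{..l}. c r * ((-1) ^ r * (real q - 1) ^ (l - r)) \<le> c r * (real q - 1) ^ l"
      by (auto intro!: mult_left_mono sign_le simp: c_def)
    show "\<exists>r\<in>{..l}. c r * ((-1) ^ r * (real q - 1) ^ (l - r)) < c r * (real q - 1) ^ l"
      using r \<open>0 < c r\<close> by (intro bexI [of _ r] mult_strict_left_mono sign_less) auto
  qed simp
  also have "\<dots> = real (i + (n - i) choose l) * (real q - 1) ^ l"
    unfolding vandermonde [symmetric] by (simp add: c_def sum_distrib_right)
  also have "\<dots> = krawtchouk l 0 n q"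
    using i by (simp add: krawtchouk_0)
  finally show ?thesis .
qed

section \<open>The idempotents of the Hamming scheme\<close>

text \<open>The tensor product, over the coordinates, of the projection \<open>I - J/q\<close> at the coordinates
  in \<open>S\<close> and of \<open>J/q\<close> at the others, where \<open>J\<close> is the \<open>q \<times> q\<close> all-ones matrix.\<close>

definition tensor_projection :: "'n set \<Rightarrow> real^('a::finite^'n)^('a^'n)" where
  "tensor_projection S = (\<chi> u v. \<Prod>c\<in>UNIV.
     if c \<in> S then of_bool (u $ c = v $ c) - 1 / real CARD('a) else 1 / real CARD('a))"

text \<open>Distributivity, which lets products of tensor-product matrices be computed one
  coordinate at a time.\<close>

lemma sum_prod_vec:
  fixes f :: "'n::finite \<Rightarrow> 'a::finite \<Rightarrow> 'c::comm_semiring_1"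
  shows "(\<Sum>w\<in>(UNIV :: ('a^'n) set). \<Prod>c\<in>UNIV. f c (w $ c)) = (\<Prod>c\<in>UNIV. \<Sum>a\<in>UNIV. f c a)"
proof -
  have "bij (vec_nth :: 'a^'n \<Rightarrow> 'n \<Rightarrow> 'a)"
    by (rule bij_betw_byWitness [where f' = vec_lambda]) (auto simp: vec_lambda_eta)
  then have "(\<Sum>w\<in>(UNIV :: ('a^'n) set). \<Prod>c\<in>UNIV. f c (w $ c)) = (\<Sum>g\<in>UNIV. \<Prod>c\<in>UNIV. f c (g c))"
    by (rule sum.reindex_bij_betw)
  then show ?thesis
    by (simp add: prod_sum_PiE)
qed

text \<open>\<open>I - J/q\<close> and \<open>J/q\<close> are idempotent with product zero, so a
  coordinate in exactly one of \<open>S\<close> and \<open>T\<close> contributes a zero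
  factor.\<close>

lemma tensor_projection_mult:
  "tensor_projection S ** tensor_projection T
    = (if S = T then tensor_projection S else (0 :: real^('a::finite^'n)^('a^'n)))"
proof -
  define p :: "bool \<Rightarrow> 'a \<Rightarrow> 'a \<Rightarrow> real"
    where "p b x y = (if b then of_bool (x = y) - 1 / real CARD('a) else 1 / real CARD('a))" for b x y
  \<comment> \<open>Evaluates the sum over \<open>a\<close> of a product of two Kronecker
    deltas.\<close>
  have "{a. x = a \<and> a = y} = (if x = y then {y} else {})" for x y :: 'a
    by auto
  then have p_mult: "(\<Sum>a\<in>UNIV. p b x a * p b' a y) = (if b = b' then p b x y else 0)" for b b' x y
    by (cases b; cases b')
      (simp_all add: p_def left_diff_distrib right_diff_distrib sum_subtractf
        sum_distrib_left [symmetric] sum_distrib_right [symmetric] sum_divide_distrib [symmetric]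
        of_bool_conj [symmetric])
  have proj: "tensor_projection S $ u $ v = (\<Prod>c\<in>UNIV. p (c \<in> S) (u $ c) (v $ c))"
    for S and u v :: "'a^'n"
    by (simp add: tensor_projection_def p_def)
  have "(tensor_projection S ** tensor_projection T) $ u $ v
      = (\<Prod>c\<in>UNIV. if (c \<in> S) = (c \<in> T) then p (c \<in> S) (u $ c) (v $ c) else 0)"
    for u v :: "'a^'n"
    by (simp add: matrix_matrix_mult_def proj prod.distrib [symmetric] p_mult
        sum_prod_vec [of "\<lambda>c a. p (c \<in> S) (u $ c) a * p (c \<in> T) a (v $ c)"])
  moreover have "(\<Prod>c\<in>UNIV. if (c \<in> S) = (c \<in> T) then p (c \<in> S) (u $ c) (v $ c) else 0)
      = (if S = T then tensor_projection S else 0) $ u $ v" for u v :: "'a^'n"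
    by (auto simp: proj prod_zero_iff)
  ultimately show ?thesis
    by (simp add: vec_eq_iff)
qed

lemma prod_hamming_dist:
  fixes u v :: "'a::finite^'n"
  shows "(\<Prod>c\<in>UNIV. if u $ c = v $ c then x else y)
    = (y :: 'b :: comm_semiring_1) ^ hamming_dist u v * x ^ (CARD('n) - hamming_dist u v)"
proof -
  have "card {c. u $ c = v $ c} = CARD('n) - hamming_dist u v"
    using card_Diff_subset [of "{c. u $ c \<noteq> v $ c}" UNIV]
    by (simp add: hamming_dist_def Compl_eq_Diff_UNIV [symmetric] Compl_eq)
  then show ?thesis
    by (simp add: prod.If_cases hamming_dist_def mult.commute Compl_eq)
qed

lemma hamming_dist_le: "hamming_dist (u :: 'a^'n) v \<le> CARD('n)"
  unfolding hamming_dist_def by (rule card_mono) auto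

lemma hamming_dist_eq_0_iff: "hamming_dist u v = 0 \<longleftrightarrow> u = v"
  by (simp add: hamming_dist_def vec_eq_iff)

lemma hamming_idempotent_nth:
  "hamming_idempotent k $ (u :: 'a::finite^'n) $ v
    = krawtchouk k (hamming_dist u v) CARD('n) CARD('a) / real CARD('a) ^ CARD('n)"
  using hamming_dist_le [of u v]
  by (simp add: hamming_idempotent_def hamming_scheme_matrix_def sum_component if_distrib cong: if_cong)

text \<open>Entrywise expansion of the tensor power of \<open>a (I - J/q) + b (J/q)\<close>. The choice
  \<open>a = x\<close>, \<open>b = 1\<close> gives the generating function of the \<open>E\<^sub>k\<close>, and \<open>a = 1 - x\<close>,
  \<open>b = 1 + (q - 1) x\<close> that of the \<open>A\<^sub>i\<close>.\<close>

lemma sum_tensor_projection_poly: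
  fixes u v :: "'a::finite^'n"
  defines "e \<equiv> \<lambda>c. of_bool (u $ c = v $ c) :: real"
  shows "(\<Prod>c\<in>UNIV. smult (e c - 1 / real CARD('a)) a + smult (1 / real CARD('a)) b)
    = (\<Sum>S\<in>UNIV. smult (tensor_projection S $ u $ v) (a ^ card S * b ^ (CARD('n) - card S)))"
  (is "(\<Prod>c\<in>UNIV. ?f c + ?g) = _")
proof -
  have "(\<Prod>c\<in>S. ?f c) * (\<Prod>c\<in>UNIV - S. ?g)
      = smult (tensor_projection S $ u $ v) (a ^ card S * b ^ (CARD('n) - card S))" for S :: "'n set"
  proof -
    have "tensor_projection S $ u $ v = (\<Prod>c\<in>S. e c - 1 / real CARD('a)) * (\<Prod>c\<in>UNIV - S. 1 / real CARD('a))"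
      by (simp add: tensor_projection_def prod.If_cases e_def Compl_eq_Diff_UNIV)
    then show ?thesis
      by (simp add: prod_smult card_Diff_subset smult_power mult.commute)
  qed
  then show ?thesis
    by (simp add: prod_add)
qed

text \<open>With \<open>a = x\<close> and \<open>b = 1\<close> the factor is
  \<open>(1 + (q - 1) x) / q\<close> where \<open>u\<close> and \<open>v\<close> agree and
  \<open>(1 - x) / q\<close> where they differ. Compare the coefficients of
  \<open>x ^ k\<close>.\<close>

lemma hamming_idempotent_eq_sum_tensor_projection:
  "(hamming_idempotent k :: real^('a::finite^'n)^('a^'n))
    = (\<Sum>S | card S = k. tensor_projection S)"
proof -
  have "hamming_idempotent k $ u $ v = (\<Sum>S | card S = k. tensor_projection S $ u $ v)"
    for u v :: "'a^'n"
  proof -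
    let ?q = "real CARD('a)" and ?n = "CARD('n)" and ?h = "hamming_dist u v"
    have scale: "(1 / ?q) ^ ?h * (1 / ?q) ^ (?n - ?h) = 1 / ?q ^ ?n"
      by (simp add: power_add [symmetric] hamming_dist_le power_one_over)
    have "(\<Sum>S\<in>UNIV. smult (tensor_projection S $ u $ v) (monom 1 1 ^ card S * 1 ^ (?n - card S)))
        = (\<Prod>c\<in>UNIV. if u $ c = v $ c then smult (1 / ?q) [:1, ?q - 1:] else smult (1 / ?q) [:1, -1:])"
      unfolding sum_tensor_projection_poly [symmetric]
      by (intro prod.cong) (auto simp: monom_Suc monom_0 one_pCons field_simps)
    also have "\<dots> = smult (1 / ?q ^ ?n) ([:1, -1:] ^ ?h * [:1, ?q - 1:] ^ (?n - ?h))"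
      using scale by (simp add: prod_hamming_dist smult_power mult.commute del: smult_pCons)
    finally have "coeff (\<Sum>S\<in>UNIV. smult (tensor_projection S $ u $ v) (monom 1 1 ^ card S * 1 ^ (?n - card S))) k
        = krawtchouk k ?h ?n CARD('a) / ?q ^ ?n"
      by (simp add: coeff_krawtchouk_poly)
    then show ?thesis
      by (simp add: coeff_sum monom_power hamming_idempotent_nth sum.If_cases if_distrib cong: if_cong)
  qed
  then show ?thesis
    by (simp add: vec_eq_iff sum_component)
qed

text \<open>With \<open>a = 1 - x\<close> and \<open>b = 1 + (q - 1) x\<close> the factor is
  \<open>1\<close> where \<open>u\<close> and \<open>v\<close> agree and \<open>x\<close> where they
  differ, so the product is \<open>x ^ hamming_dist u v\<close>.\<close>

lemma hamming_scheme_matrix_decomposition: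
  "(hamming_scheme_matrix i :: real^('a::finite^'n)^('a^'n))
    = (\<Sum>k=0..CARD('n). krawtchouk i k CARD('n) CARD('a) *\<^sub>R hamming_idempotent k)"
proof -
  let ?q = "real CARD('a)" and ?n = "CARD('n)"
  have "hamming_scheme_matrix i $ u $ v
      = (\<Sum>k=0..?n. krawtchouk i k ?n CARD('a) * hamming_idempotent k $ u $ v)" for u v :: "'a^'n"
  proof -
    have "monom 1 (hamming_dist u v) = (\<Prod>c\<in>UNIV. if u $ c = v $ c then 1 else monom (1::real) 1)"
      by (simp add: prod_hamming_dist monom_power)
    also have "\<dots> = (\<Sum>S\<in>UNIV. smult (tensor_projection S $ u $ v)
        ([:1, -1:] ^ card S * [:1, ?q - 1:] ^ (?n - card S)))"
      unfolding sum_tensor_projection_poly [symmetric]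
      by (intro prod.cong) (auto simp: monom_Suc monom_0 one_pCons field_simps)
    finally have "coeff (monom 1 (hamming_dist u v)) i
        = (\<Sum>S\<in>UNIV. tensor_projection S $ u $ v * krawtchouk i (card S) ?n CARD('a))"
      by (simp add: coeff_sum coeff_krawtchouk_poly)
    also have "\<dots> = (\<Sum>k=0..?n. \<Sum>S | card S = k. tensor_projection S $ u $ v * krawtchouk i (card S) ?n CARD('a))"
      using sum.group [of "UNIV :: 'n set set" "{0..?n}" card
          "\<lambda>S. tensor_projection S $ u $ v * krawtchouk i (card S) ?n CARD('a)"]
      by (simp add: image_subset_iff card_mono)
    also have "\<dots> = (\<Sum>k=0..?n. krawtchouk i k ?n CARD('a) * hamming_idempotent k $ u $ v)"
      by (simp add: hamming_idempotent_eq_sum_tensor_projection sum_component sum_distrib_left mult.commute)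
    finally show ?thesis
      by (simp add: hamming_scheme_matrix_def)
  qed
  then show ?thesis
    by (simp add: vec_eq_iff sum_component)
qed

lemma hamming_idempotent_mult:
  "hamming_idempotent i ** hamming_idempotent j
    = (if i = j then hamming_idempotent i else (0 :: real^('a::finite^'n)^('a^'n)))"
  by (cases "i = j")
    (simp_all add: hamming_idempotent_eq_sum_tensor_projection matrix_mult_sum_left
      matrix_mult_sum_right tensor_projection_mult)

lemma spectral_decomposition_hamming_idempotent:
  assumes "2 \<le> CARD('a)"
  shows "spectral_decomposition {0..CARD('n)} (hamming_idempotent :: nat \<Rightarrow> real^('a::finite^'n)^('a^'n))"
proof
  have "hamming_scheme_matrix 0 = (mat 1 :: real^('a^'n)^('a^'n))"
    by (simp add: vec_eq_iff hamming_scheme_matrix_def mat_def hamming_dist_eq_0_iff)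
  then show "(\<Sum>j=0..CARD('n). hamming_idempotent j) = (mat 1 :: real^('a^'n)^('a^'n))"
    using hamming_scheme_matrix_decomposition [of 0, where 'a = 'a and 'n = 'n]
    by (simp add: krawtchouk_zero_deg)
next
  fix j
  assume j: "j \<in> {0..CARD('n)}"
  \<comment> \<open>The diagonal entry is \<open>(n choose j) * (q - 1) ^ j / q ^ n\<close>.\<close>
  have "hamming_idempotent j $ u $ u \<noteq> 0" for u :: "'a^'n"
    using assms j hamming_dist_eq_0_iff [of u u] by (simp add: hamming_idempotent_nth krawtchouk_0)
  then show "(hamming_idempotent j :: real^('a^'n)^('a^'n)) \<noteq> 0"
    by (metis zero_index)
qed (simp_all add: hamming_idempotent_mult)

text \<open>\<open>E 0\<close> is constant with entries \<open>1 / q ^ n\<close>, so row sums of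
  \<open>E k\<close> can be read off \<open>E k ** E 0\<close>.\<close>

lemma sum_row_hamming_idempotent:
  "(\<Sum>v\<in>UNIV. hamming_idempotent k $ (u :: 'a::finite^'n) $ v) = of_bool (k = 0)"
proof -
  let ?N = "real CARD('a) ^ CARD('n)"
  have E_0: "hamming_idempotent 0 $ v $ w = 1 / ?N" for v w :: "'a^'n"
    by (simp add: hamming_idempotent_nth krawtchouk_zero_deg)
  have "(\<Sum>v\<in>UNIV. hamming_idempotent k $ u $ v) / ?N = (hamming_idempotent k ** hamming_idempotent 0) $ u $ u"
    by (simp add: matrix_matrix_mult_def E_0 sum_divide_distrib)
  also have "\<dots> = of_bool (k = 0) / ?N"
    by (simp add: hamming_idempotent_mult E_0)
  finally show ?thesis
    by simp
qed

section \<open>Complements of generalized Hamming graphs\<close>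

lemma complement_gen_hamming_graph_iff:
  assumes "0 < d"
  shows "graph_complement (gen_hamming_graph d) u v \<longleftrightarrow> d \<le> hamming_dist u v"
  using assms hamming_dist_eq_0_iff [of u v]
  by (auto simp: graph_complement_def gen_hamming_graph_def)

lemma adjacency_matrix_complement_gen_hamming_graph:
  assumes "0 < d"
  shows "adjacency_matrix (graph_complement (gen_hamming_graph d))
    = (\<Sum>i=d..CARD('n). hamming_scheme_matrix i :: real^('a::finite^'n)^('a^'n))"
  using assms hamming_dist_le [where 'a = 'a and 'n = 'n]
  by (simp add: vec_eq_iff adjacency_matrix_def complement_gen_hamming_graph_iff sum_component
      hamming_scheme_matrix_def)

lemma vertex_degree_eq_sum_row: "real (vertex_degree G u) = (\<Sum>v\<in>UNIV. adjacency_matrix G $ u $ v)"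
  by (simp add: vertex_degree_def adjacency_matrix_def sum.If_cases)

theorem theorem4p4p10:
  fixes G :: "('a::{field,finite})^'n \<Rightarrow> 'a^'n \<Rightarrow> bool"
    and E :: "nat \<Rightarrow> real^('a^'n)^('a^'n)"
    and \<gamma> :: "nat \<Rightarrow> real"
    and q n d \<Delta> :: nat
  assumes "q = CARD('a)" and "n = CARD('n)"
    and "2 \<le> d" and "d \<le> n"
    and "G = graph_complement (gen_hamming_graph d)"
    and "E = hamming_idempotent"
    and "\<Delta> = (\<Sum>i=d..n. (n choose i) * (q - 1) ^ i)"
    and "\<gamma> 0 = real \<Delta>"
    and "\<And>j. 1 \<le> j \<Longrightarrow> j \<le> n \<Longrightarrow> \<gamma> j = - krawtchouk (d - 1) (j - 1) (n - 1) q"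
  shows "(\<forall>v. vertex_degree G v = \<Delta>) \<and>
         adjacency_matrix G = (\<Sum>j=0..n. \<gamma> j *\<^sub>R E j) \<and>
         {c. matrix_eigenvalue (adjacency_matrix G) c} = \<gamma> ` {0..n} \<and>
         (\<forall>m. 2 \<le> m \<and> m \<le> n - 1 \<and> \<not> (q = 2 \<and> d = n \<and> odd m) \<longrightarrow> \<gamma> 1 < \<gamma> m) \<and>
         (\<gamma> 1 = \<gamma> n \<longleftrightarrow> q = 2 \<and> odd d) \<and>
         (\<forall>p. matrix_poly p (adjacency_matrix G) = (\<Sum>j=0..n. poly p (\<gamma> j) *\<^sub>R E j))"
proof -
  have q: "2 \<le> q"
    using card_mono [of UNIV "{0, 1 :: 'a}"] assms(1) by simp
  interpret spectral_decomposition "{0..n}" E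
    using spectral_decomposition_hamming_idempotent q assms by metis
  have \<gamma>_eq: "\<gamma> j = (\<Sum>i=d..n. krawtchouk i j n q)" if "j \<le> n" for j
  proof (cases j)
    case 0
    have "real (q - 1) = real q - 1"
      using q by simp
    with 0 show ?thesis
      using assms by (simp add: krawtchouk_0)
  next
    case (Suc i)
    then show ?thesis
      using sum_krawtchouk [of i "n - 1" "d - 1" q] assms that by simp
  qed
  have "adjacency_matrix G = (\<Sum>i=d..n. \<Sum>j=0..n. krawtchouk i j n q *\<^sub>R E j)"
    using assms by (simp add: adjacency_matrix_complement_gen_hamming_graph hamming_scheme_matrix_decomposition)
  also have "\<dots> = (\<Sum>j=0..n. \<Sum>i=d..n. krawtchouk i j n q *\<^sub>R E j)"
    by (rule sum.swap)
  also have "\<dots> = (\<Sum>j=0..n. \<gamma> j *\<^sub>R E j)"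
    by (simp add: \<gamma>_eq scaleR_sum_left)
  finally have A_eq: "adjacency_matrix G = (\<Sum>j=0..n. \<gamma> j *\<^sub>R E j)" .
  \<comment> \<open>Only \<open>E 0\<close> has nonzero row sums, so the degree is
    \<open>\<gamma> 0\<close>.\<close>
  have degree: "vertex_degree G v = \<Delta>" for v
  proof -
    have "real (vertex_degree G v) = (\<Sum>w\<in>UNIV. \<Sum>j=0..n. \<gamma> j * E j $ v $ w)"
      by (simp add: vertex_degree_eq_sum_row A_eq sum_component)
    also have "\<dots> = (\<Sum>j=0..n. \<Sum>w\<in>UNIV. \<gamma> j * E j $ v $ w)"
      by (rule sum.swap)
    also have "\<dots> = (\<Sum>j=0..n. \<gamma> j * of_bool (j = 0))"
      by (simp add: sum_distrib_left [symmetric] assms(6) sum_row_hamming_idempotent)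
    also have "\<dots> = real \<Delta>"
      by (simp add: assms(8))
    finally show ?thesis
      by simp
  qed
  \<comment> \<open>The shift to \<open>i = m - 1\<close> turns odd \<open>m\<close> into the even
    \<open>i\<close> of the exception.\<close>
  have strict: "\<gamma> 1 < \<gamma> m" if "2 \<le> m" "m \<le> n - 1" "\<not> (q = 2 \<and> d = n \<and> odd m)" for m
    using krawtchouk_less_krawtchouk_0 [of q "m - 1" "n - 1" "d - 1"] that q assms by auto
  have "\<gamma> 1 = \<gamma> n \<longleftrightarrow> real (n - 1 choose (d - 1)) * (real q - 1) ^ (d - 1)
      = real (n - 1 choose (d - 1)) * (-1) ^ (d - 1)"
    using assms by (simp add: krawtchouk_0 krawtchouk_last)
  also have "\<dots> \<longleftrightarrow> (real q - 1) ^ (d - 1) = (-1) ^ (d - 1)"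
    using assms(3,4) by (subst mult_cancel_left) (auto simp: binomial_eq_0_iff)
  also have "\<dots> \<longleftrightarrow> q = 2 \<and> odd d"
  proof (cases "q = 2")
    case True
    then show ?thesis
      using assms by (auto simp: minus_one_power_iff)
  next
    case False
    then have "1 ^ (d - 1) < (real q - 1) ^ (d - 1)"
      using q assms by (intro power_strict_mono) auto
    then show ?thesis
      using False by (auto simp: minus_one_power_iff)
  qed
  finally show ?thesis
    using degree strict A_eq eigenvalues_combination [of \<gamma>] matrix_poly_combination [of _ \<gamma>] by simp
qed

end
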